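(* For any function $f : [0,1] \to \mathbb{R}$ (no continuity or measurability assumed), the graph $G_f := \{(x,f(x)) : x \in [0,1]\} \subset \mathbb{R}^2$ satisfies $$\dim_{\mathrm{F}} G_f \leq 1,$$ where $\dim_{\mathrm{F}}$ denotes Fourier dimension.
   Context: For a Borel probability measure $\mu$ on $\mathbb{R}^2$, the Fourier transform is $\widehat{\mu}(\xi) := \int_{\mathbb{R}^2} e^{-2\pi i x\cdot \xi}\, d\mu(x)$, $\xi \in \mathbb{R}^2$. For a set $K \subset \mathbb{R}^2$, let $\mathcal{P}(K)$ be the family of all Borel probability measures $\mu$ on $\mathbb{R}^2$ supported on $K$, meaning that the (closed) support satisfies $\operatorname{spt}\mu \subset K$. The Fourier dimension of $K$ is $$\dim_{\mathrm{F}} K := \sup\{0 \leq s \leq 2 : \text{there exist } \mu \in \mathcal{P}(K) \text{ and a constant } C>0 \text{ such that } |\widehat{\mu}(\xi)| \leq C|\xi|^{-s/2} \text{ for all } \xi \in \mathbb{R}^2\setminus\{0\}\}.$$ *)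

theory Defs
  imports "HOL-Probability.Probability"
begin

definition measure_support :: "'a::topological_space measure \<Rightarrow> 'a set" where
  "measure_support M = {x. \<forall>U. open U \<longrightarrow> x \<in> U \<longrightarrow> emeasure M U > 0}"

definition borel_prob_measures_on :: "'a::topological_space set \<Rightarrow> 'a measure set" where
  "borel_prob_measures_on K =
     {M. prob_space M \<and> sets M = sets borel \<and> measure_support M \<subseteq> K}"

definition fourier_transform :: "(real \<times> real) measure \<Rightarrow> real \<times> real \<Rightarrow> complex" where
  "fourier_transform M \<xi> =
     (LINT x|M. exp (- 2 * complex_of_real pi * \<i> * complex_of_real (x \<bullet> \<xi>)))"

definition fourier_decay_exponents :: "(real \<times> real) set \<Rightarrow> real set" where
  "fourier_decay_exponents K =
     {s. 0 \<le> s \<and> s \<le> 2 \<and>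
        (\<exists>M \<in> borel_prob_measures_on K. \<exists>C > 0. \<forall>\<xi>. \<xi> \<noteq> 0 \<longrightarrow>
           norm (fourier_transform M \<xi>) \<le> C * norm \<xi> powr (- s / 2))}"

text \<open>
  The real supremum is meaningful when \<open>K\<close> is nonempty: then the set of exponents contains 0,
  as shown below. For empty \<open>K\<close> the value is unspecified.
\<close>
definition fourier_dim :: "(real \<times> real) set \<Rightarrow> real" where
  "fourier_dim K = Sup (fourier_decay_exponents K)"

lemma bdd_above_fourier_decay_exponents: "bdd_above (fourier_decay_exponents K)"
  unfolding fourier_decay_exponents_def bdd_above_def by blast

lemma measure_support_return:
  fixes a :: "'a::t1_space"
  shows "measure_support (return borel a) = {a}"
proof -
  have "emeasure (return borel a) (- {a}) = 0"
    by simp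
  moreover have "open (- {a})"
    by (simp add: open_Compl)
  ultimately have "x = a" if "x \<in> measure_support (return borel a)" for x
    using that unfolding measure_support_def
    by (metis (mono_tags, lifting) ComplI mem_Collect_eq not_less_zero singletonD)
  moreover have "a \<in> measure_support (return borel a)"
    by (auto simp: measure_support_def)
  ultimately show ?thesis
    by blast
qed

lemma zero_in_fourier_decay_exponents:
  assumes "a \<in> K"
  shows "0 \<in> fourier_decay_exponents K"
proof -
  have "return borel a \<in> borel_prob_measures_on K"
    using assms
    by (simp add: borel_prob_measures_on_def measure_support_return prob_space_return)
  moreover have "norm (fourier_transform (return borel a) \<xi>) = 1" for \<xi>
  proof -
    have "fourier_transform (return borel a) \<xi> =
        exp (- 2 * complex_of_real pi * \<i> * complex_of_real (a \<bullet> \<xi>))"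
      unfolding fourier_transform_def by (subst integral_return) auto
    then show ?thesis
      by (simp add: norm_exp_eq_Re)
  qed
  ultimately show ?thesis
    unfolding fourier_decay_exponents_def
    by (auto intro!: bexI[of _ "return borel a"] exI[of _ "1::real"])
qed

end

theory Submission
  imports Defs
begin

text \<open>
  If a measure \<open>\<mu>\<close> on the graph decayed with exponent \<open>s > 1\<close>, then \<open>\<integral> |\<mu>^(t, c)|\<^sup>2 dt\<close> would tend to 0 as
  \<open>c \<rightarrow> \<infinity>\<close>. By Plancherel, however, this integral should not depend on \<open>c\<close>: the measure has the
  form \<open>g(x) dx \<delta>\<^bsub>f(x)\<^esub>\<close>, and frequency \<open>c\<close> merely multiplies \<open>g\<close> by a unimodular function.
  To avoid densities, \<open>|\<mu>^(n u, b v)|\<^sup>2\<close> is averaged over independent standard normal \<open>u, v\<close>.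
  This average equals the Gaussian energy
  \<open>\<integral>\<integral> exp (- 2 \<pi>\<^sup>2 (n\<^sup>2 (x - x')\<^sup>2 + b\<^sup>2 (y - y')\<^sup>2)) d\<mu> d\<mu>\<close>. As a compact graph is uniformly
  continuous, for \<open>n\<close> large (depending on \<open>b\<close>) pairs in a common vertical strip of width \<open>1 / n\<close>
  already contribute at least \<open>\<delta> / n\<close> with \<open>\<delta> > 0\<close> independent of \<open>b\<close>, whereas the decay bounds
  the average by \<open>\<epsilon>(b) / n\<close> with \<open>\<epsilon>(b) \<rightarrow> 0\<close>.
\<close>

section \<open>Supports and compact subsets of positive measure\<close>

text \<open>By Lindelof, the union of all open null sets is already a union of countably many of
  them, hence null. It is open and is the complement of the support.\<close>

lemma
  fixes M :: "'a::second_countable_topology measure"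
  assumes "sets M = sets borel"
  shows emeasure_Compl_measure_support: "emeasure M (- measure_support M) = 0"
    and closed_measure_support: "closed (measure_support M)"
proof -
  define \<F> where "\<F> = {U. open U \<and> emeasure M U = 0}"
  have eq: "- measure_support M = \<Union>\<F>"
    by (auto simp: \<F>_def measure_support_def)
  obtain \<F>' where \<F>': "\<F>' \<subseteq> \<F>" "countable \<F>'" "\<Union>\<F>' = \<Union>\<F>"
    by (rule Lindelof[of \<F>]) (auto simp: \<F>_def)
  have "(\<Union>U\<in>\<F>'. U) \<in> null_sets M"
    using \<F>' assms by (intro null_sets_UN') (auto simp: \<F>_def null_sets_def)
  then show "emeasure M (- measure_support M) = 0"
    using \<F>' eq by (auto simp: null_sets_def)
  have "open (\<Union>\<F>)"
    by (auto simp: \<F>_def)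
  then show "closed (measure_support M)"
    using eq by (simp add: closed_def)
qed

lemma measure_measure_support:
  fixes M :: "'a::second_countable_topology measure"
  assumes "prob_space M" and M: "sets M = sets borel"
  shows "measure M (measure_support M) = 1"
proof -
  interpret prob_space M by fact
  have sp: "space M = UNIV"
    using sets_eq_imp_space_eq[OF M] by simp
  have "measure_support M \<in> sets M"
    using closed_measure_support[OF M] M by simp
  from prob_compl[OF this] show ?thesis
    using emeasure_Compl_measure_support[OF M] sp
    by (simp add: measure_def Compl_eq_Diff_UNIV)
qed

text \<open>Exhaustion by closed balls and continuity from below. The support of a measure on the
  graph is closed but possibly unbounded, since the function is arbitrary; this cuts out a compact
  piece of it.\<close>

lemma exists_compact_subset_positive_measure:
  fixes M :: "'a::{heine_borel,real_normed_vector} measure"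
  assumes "finite_measure M" "sets M = sets borel" and S: "closed S" "measure M S > 0"
  obtains K where "compact K" "K \<subseteq> S" "measure M K > 0"
proof -
  interpret finite_measure M by fact
  have "(\<lambda>n. measure M (S \<inter> cball 0 (real n))) \<longlonglongrightarrow> measure M (\<Union>n. S \<inter> cball 0 (real n))"
    using assms by (intro finite_Lim_measure_incseq) (auto simp: incseq_def intro!: borel_closed)
  moreover have "(\<Union>n. S \<inter> cball 0 (real n)) = S"
    by (auto simp: real_arch_simple)
  ultimately have "eventually (\<lambda>n. measure M (S \<inter> cball 0 (real n)) > 0) sequentially"
    using S(2) by (auto dest: order_tendstoD)
  then obtain n where "measure M (S \<inter> cball 0 (real n)) > 0"
    by (auto simp: eventually_sequentially)
  then show ?thesis
    using S(1) by (intro that[of "S \<inter> cball 0 (real n)"]) (auto intro: closed_Int_compact)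
qed

section \<open>Compact graphs and thin vertical strips\<close>

text \<open>Uniform continuity of the function whose graph is \<open>K\<close>. On the compact set
  of pairs at vertical distance at least \<open>d\<close>, the horizontal distance attains its
  minimum, which is positive because points with equal abscissa coincide.\<close>

lemma compact_graph_modulus:
  fixes K :: "('a::metric_space \<times> 'b::metric_space) set"
  assumes "compact K" "inj_on fst K" "d > 0"
  obtains e where "e > 0"
    "\<And>p q. p \<in> K \<Longrightarrow> q \<in> K \<Longrightarrow> dist (fst p) (fst q) < e \<Longrightarrow> dist (snd p) (snd q) < d"
proof -
  define T where "T = {z \<in> K \<times> K. d \<le> dist (snd (fst z)) (snd (snd z))}"
  have "T = (K \<times> K) \<inter> {z. d \<le> dist (snd (fst z)) (snd (snd z))}"
    by (auto simp: T_def)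
  then have "compact T"
    using assms(1) by (auto intro!: compact_Int_closed compact_Times closed_Collect_le continuous_intros)
  show ?thesis
  proof (cases "T = {}")
    case True
    then show ?thesis
      by (intro that[of 1]) (force simp: T_def not_le)+
  next
    case False
    have "continuous_on T (\<lambda>z. dist (fst (fst z)) (fst (snd z)))"
      by (intro continuous_intros)
    then obtain z where z: "z \<in> T"
      "\<And>w. w \<in> T \<Longrightarrow> dist (fst (fst z)) (fst (snd z)) \<le> dist (fst (fst w)) (fst (snd w))"
      using continuous_attains_inf[OF \<open>compact T\<close> False] by blast
    have "fst (fst z) \<noteq> fst (snd z)"
    proof
      assume "fst (fst z) = fst (snd z)"
      then have "fst z = snd z"
        using z(1) assms(2) by (auto simp: T_def dest: inj_onD)
      then show False
        using z(1) assms(3) by (auto simp: T_def)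
    qed
    then show ?thesis
      using z(2) by (intro that[of "dist (fst (fst z)) (fst (snd z))"]) (force simp: T_def not_le)+
  qed
qed

text \<open>Cauchy--Schwarz over the \<open>n + 1\<close> strips \<open>\<lfloor>n x\<rfloor> = j\<close>.\<close>
lemma measure_strip_ge:
  fixes M :: "(real \<times> 'b::second_countable_topology) measure"
  assumes "finite_measure M" and M: "sets M = sets borel" and K: "K \<in> sets M" "fst ` K \<subseteq> {0..1}" and n: "n > (0::nat)"
  shows "(measure M K)\<^sup>2 / (real n + 1) \<le>
    measure (M \<Otimes>\<^sub>M M) {z \<in> K \<times> K. \<bar>fst (fst z) - fst (snd z)\<bar> \<le> 1 / real n}"
proof -
  interpret finite_measure M by fact
  interpret P: pair_sigma_finite M M ..
  interpret PM: finite_measure "M \<Otimes>\<^sub>M M"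
    by (rule finite_measure_pair_measure) unfold_locales
  have [measurable_cong]: "sets M = sets (borel \<Otimes>\<^sub>M borel)"
    unfolding M borel_prod ..
  note [measurable] = K(1)
  have sp: "space M = UNIV"
    using sets_eq_imp_space_eq[OF M] by simp
  define I where "I j = {p \<in> K. \<lfloor>real n * fst p\<rfloor> = int j}" for j
  define S where "S = {z \<in> K \<times> K. \<bar>fst (fst z) - fst (snd z)\<bar> \<le> 1 / real n}"
  have "{p \<in> space M. p \<in> K \<and> \<lfloor>real n * fst p\<rfloor> = int j} \<in> sets M" for j
    by measurable
  then have I[measurable]: "I j \<in> sets M" for j
    by (simp add: I_def sp)
  have "{z \<in> space (M \<Otimes>\<^sub>M M). z \<in> K \<times> K \<and> \<bar>fst (fst z) - fst (snd z)\<bar> \<le> 1 / real n} \<in> sets (M \<Otimes>\<^sub>M M)"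
    by measurable
  then have S: "S \<in> sets (M \<Otimes>\<^sub>M M)"
    by (simp add: S_def sp space_pair_measure)
  have disj: "disjoint_family_on I {..n}"
    by (auto simp: disjoint_family_on_def I_def)
  \<comment> \<open>The index \<open>n\<close> itself is included because abscissa 1 falls into
    strip \<open>n\<close>.\<close>
  have "p \<in> (\<Union>j\<in>{..n}. I j)" if "p \<in> K" for p
  proof -
    have "0 \<le> fst p" "fst p \<le> 1"
      using K(2) that by auto
    then have "0 \<le> real n * fst p" "real n * fst p \<le> real n"
      by (auto simp: mult_left_le)
    then have "0 \<le> \<lfloor>real n * fst p\<rfloor>" "\<lfloor>real n * fst p\<rfloor> \<le> int n"
      by (auto simp: floor_le_iff)
    then show ?thesis
      using that by (auto simp: I_def intro!: bexI[of _ "nat \<lfloor>real n * fst p\<rfloor>"])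
  qed
  then have "K = (\<Union>j\<in>{..n}. I j)"
    by (auto simp: I_def)
  then have "measure M K = (\<Sum>j\<le>n. measure M (I j))"
    using finite_measure_finite_Union[OF _ _ disj] I by (simp add: image_subset_iff)
  then have cs: "(measure M K)\<^sup>2 \<le> (\<Sum>j\<le>n. (measure M (I j))\<^sup>2) * (real n + 1)"
    using sum_squared_le_sum_of_squares[of "\<lambda>j. measure M (I j)" "{..n}"] by (simp add: add.commute)
  \<comment> \<open>Squared masses are product masses of the disjoint diagonal blocks
    \<open>I j \<times> I j\<close>, all of which lie in \<open>S\<close>.\<close>
  have "(\<Sum>j\<le>n. (measure M (I j))\<^sup>2) = (\<Sum>j\<le>n. measure (M \<Otimes>\<^sub>M M) (I j \<times> I j))"
    by (simp add: measure_def emeasure_pair_measure_Times enn2real_mult power2_eq_square)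
  also have "\<dots> = measure (M \<Otimes>\<^sub>M M) (\<Union>j\<le>n. I j \<times> I j)"
    using disj by (intro PM.finite_measure_finite_Union[symmetric]) (auto simp: disjoint_family_on_def)
  also have "\<dots> \<le> measure (M \<Otimes>\<^sub>M M) S"
  proof (rule PM.finite_measure_mono[OF _ S])
    have "\<bar>x - y\<bar> \<le> 1 / real n" if "\<lfloor>real n * x\<rfloor> = int j" "\<lfloor>real n * y\<rfloor> = int j" for x y j
    proof -
      have "\<bar>real n * x - real n * y\<bar> \<le> 1"
        using that by linarith
      then have "real n * \<bar>x - y\<bar> \<le> 1"
        by (metis abs_mult abs_of_nat right_diff_distrib)
      then show ?thesis
        using n by (simp add: field_simps)
    qed
    then show "(\<Union>j\<le>n. I j \<times> I j) \<subseteq> S"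
      by (auto simp: S_def I_def)
  qed
  finally have "(\<Sum>j\<le>n. (measure M (I j))\<^sup>2) * (real n + 1) \<le> measure (M \<Otimes>\<^sub>M M) S * (real n + 1)"
    by (rule mult_right_mono) simp
  with cs have "(measure M K)\<^sup>2 \<le> measure (M \<Otimes>\<^sub>M M) S * (real n + 1)"
    by (rule order_trans)
  then show ?thesis
    by (simp add: S_def pos_divide_le_eq)
qed

section \<open>The Gaussian energy identity\<close>

lemma integral_pair_mult:
  fixes f :: "'a \<Rightarrow> complex" and g :: "'b \<Rightarrow> complex"
  assumes "finite_measure M" "finite_measure N"
    and [measurable]: "f \<in> borel_measurable M" "g \<in> borel_measurable N"
    and bd: "\<And>x. norm (f x) \<le> B" "\<And>y. norm (g y) \<le> C"
  shows "(LINT z|(M \<Otimes>\<^sub>M N). f (fst z) * g (snd z)) = (LINT x|M. f x) * (LINT y|N. g y)"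
proof -
  interpret M: finite_measure M by fact
  interpret N: finite_measure N by fact
  interpret P: pair_sigma_finite M N ..
  interpret PM: finite_measure "M \<Otimes>\<^sub>M N"
    by (rule finite_measure_pair_measure) fact+
  have "integrable (M \<Otimes>\<^sub>M N) (\<lambda>z. f (fst z) * g (snd z))"
    by (rule PM.integrable_const_bound[of _ "B * C"])
      (auto simp: norm_mult intro!: mult_mono bd order_trans[OF norm_ge_zero bd(1)])
  from P.integral_fst'[OF this] show ?thesis
    by simp
qed

text \<open>Kept syntactically equal to the integrand of \<open>fourier_transform\<close>, so that
  it can be folded in by rewriting.\<close>

definition fourier_kernel :: "real \<times> real \<Rightarrow> real \<times> real \<Rightarrow> complex" where
  "fourier_kernel \<xi> x = exp (- 2 * complex_of_real pi * \<i> * complex_of_real (x \<bullet> \<xi>))"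

lemma norm_fourier_kernel [simp]: "norm (fourier_kernel \<xi> x) = 1"
  by (simp add: fourier_kernel_def norm_exp_eq_Re)

lemma fourier_kernel_measurable:
  assumes "f \<in> borel_measurable M" "g \<in> borel_measurable M"
  shows "(\<lambda>z. fourier_kernel (f z) (g z)) \<in> borel_measurable M"
  using assms unfolding fourier_kernel_def by measurable

lemma fourier_kernel_mult_cnj: "fourier_kernel \<xi> x * cnj (fourier_kernel \<xi> y) = fourier_kernel \<xi> (x - y)"
  by (simp add: fourier_kernel_def exp_cnj flip: exp_add) (simp add: algebra_simps inner_diff_left)

text \<open>The square is the transform times its conjugate. The product becomes one integral over
  pairs, where multiplicativity of the kernel leaves only the difference of the points.\<close>

lemma norm_fourier_transform_square:
  assumes "prob_space M" "sets M = sets borel"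
  shows "complex_of_real ((norm (fourier_transform M \<xi>))\<^sup>2) =
    (LINT z|(M \<Otimes>\<^sub>M M). fourier_kernel \<xi> (fst z - snd z))"
proof -
  interpret prob_space M by fact
  have [measurable]: "fourier_kernel \<xi> \<in> borel_measurable M"
    using fourier_kernel_measurable[of "\<lambda>_. \<xi>" M "\<lambda>x. x"] assms(2)
    by (auto simp: measurable_def sets_eq_imp_space_eq[OF assms(2)])
  have [measurable]: "cnj \<in> borel_measurable borel"
    by (intro borel_measurable_continuous_onI continuous_intros)
  have "complex_of_real ((norm (fourier_transform M \<xi>))\<^sup>2) =
    (LINT x|M. fourier_kernel \<xi> x) * (LINT x|M. cnj (fourier_kernel \<xi> x))"
    unfolding fourier_transform_def fourier_kernel_def[symmetric]
    by (simp only: complex_norm_square) simp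
  also have "\<dots> = (LINT z|(M \<Otimes>\<^sub>M M). fourier_kernel \<xi> (fst z) * cnj (fourier_kernel \<xi> (snd z)))"
    by (rule integral_pair_mult[symmetric, where B=1 and C=1]) (auto intro: finite_measure_axioms)
  finally show ?thesis
    by (simp add: fourier_kernel_mult_cnj)
qed

lemma norm_fourier_transform_le_1:
  assumes "prob_space M"
  shows "norm (fourier_transform M \<xi>) \<le> 1"
proof -
  interpret prob_space M by fact
  have "norm (fourier_transform M \<xi>) \<le> (LINT x|M. norm (fourier_kernel \<xi> x))"
    unfolding fourier_transform_def fourier_kernel_def by (rule integral_norm_bound)
  also have "\<dots> = 1"
    by (simp add: prob_space)
  finally show ?thesis .
qed

lemma prob_space_std_normal_distribution: "prob_space std_normal_distribution"
  using real_dist_normal_dist by (simp add: real_distribution_def)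

text \<open>The kernel factors over the coordinates, so its average is a product of two
  characteristic functions \<open>exp (- t\<^sup>2 / 2)\<close>, at
  \<open>t = - 2 * pi * a * fst x\<close> and \<open>t = - 2 * pi * b * snd x\<close>.\<close>

lemma integral_fourier_kernel_gaussian:
  "(LINT w|(std_normal_distribution \<Otimes>\<^sub>M std_normal_distribution).
      fourier_kernel (a * fst w, b * snd w) x) =
    complex_of_real (exp (- 2 * pi\<^sup>2 * ((a * fst x)\<^sup>2 + (b * snd x)\<^sup>2)))"
proof -
  interpret prob_space std_normal_distribution by (rule prob_space_std_normal_distribution)
  have "fourier_kernel (a * fst w, b * snd w) x =
    iexp (- 2 * pi * a * fst x * fst w) * iexp (- 2 * pi * b * snd x * snd w)" for w
    by (simp add: fourier_kernel_def inner_prod_def algebra_simps flip: exp_add)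
  then have "(LINT w|(std_normal_distribution \<Otimes>\<^sub>M std_normal_distribution).
      fourier_kernel (a * fst w, b * snd w) x) =
    char std_normal_distribution (- 2 * pi * a * fst x) *
    char std_normal_distribution (- 2 * pi * b * snd x)"
    unfolding char_def
    by (simp only:) (rule integral_pair_mult[where B=1 and C=1], auto intro: finite_measure_axioms)
  also have "\<dots> = complex_of_real (exp (- 2 * pi\<^sup>2 * ((a * fst x)\<^sup>2 + (b * snd x)\<^sup>2)))"
    by (simp add: char_std_normal_distribution power_mult_distrib algebra_simps flip: of_real_mult exp_add)
  finally show ?thesis .
qed

text \<open>The substitute for Plancherel: Fubini moves the average over frequencies inside the
  double integral over points. It applies since the kernel has modulus 1 on a product of probability
  spaces.\<close>

lemma gaussian_energy:
  assumes "prob_space M" and M: "sets M = sets borel"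
  shows "(LINT w|(std_normal_distribution \<Otimes>\<^sub>M std_normal_distribution).
      (norm (fourier_transform M (a * fst w, b * snd w)))\<^sup>2) =
    (LINT z|(M \<Otimes>\<^sub>M M). exp (- 2 * pi\<^sup>2 *
      ((a * (fst (fst z) - fst (snd z)))\<^sup>2 + (b * (snd (fst z) - snd (snd z)))\<^sup>2)))"
    (is "integral\<^sup>L ?W ?l = integral\<^sup>L ?Q ?r")
proof -
  interpret M: prob_space M by fact
  interpret N: prob_space std_normal_distribution by (rule prob_space_std_normal_distribution)
  interpret W: prob_space ?W by (rule prob_space_pair) unfold_locales
  interpret Q: prob_space ?Q by (rule prob_space_pair) unfold_locales
  interpret P: pair_sigma_finite ?W ?Q ..
  interpret PP: prob_space "?W \<Otimes>\<^sub>M ?Q" by (rule prob_space_pair) unfold_locales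
  note [measurable_cong] = M
  let ?k = "\<lambda>w z. fourier_kernel (a * fst w, b * snd w) (fst z - snd z)"
  have int: "integrable (?W \<Otimes>\<^sub>M ?Q) (case_prod ?k)"
  proof (rule PP.integrable_const_bound[of _ 1])
    show "case_prod ?k \<in> borel_measurable (?W \<Otimes>\<^sub>M ?Q)"
      unfolding case_prod_beta by (intro fourier_kernel_measurable) measurable
  qed auto
  have "complex_of_real (integral\<^sup>L ?W ?l) = (LINT w|?W. complex_of_real (?l w))"
    by (rule integral_complex_of_real[symmetric])
  also have "\<dots> = (LINT w|?W. LINT z|?Q. ?k w z)"
    by (simp only: norm_fourier_transform_square[OF assms])
  also have "\<dots> = (LINT z|?Q. LINT w|?W. ?k w z)"
    by (rule P.Fubini_integral[OF int, symmetric])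
  also have "\<dots> = (LINT z|?Q. complex_of_real (?r z))"
    by (simp only: integral_fourier_kernel_gaussian fst_diff snd_diff)
  also have "\<dots> = complex_of_real (integral\<^sup>L ?Q ?r)"
    by (rule integral_complex_of_real)
  finally show ?thesis
    by (simp only: of_real_eq_iff)
qed

section \<open>Power decay integrated against the normal distribution\<close>

lemma nn_integral_powr_decay_le:
  assumes "\<alpha> > (1::real)"
  shows "(\<integral>\<^sup>+t. ennreal ((1 + \<bar>t\<bar>) powr -\<alpha>) \<partial>lborel) \<le> ennreal (2 / (\<alpha> - 1))"
proof -
  let ?h = "\<lambda>t::real. ennreal ((1 + \<bar>t\<bar>) powr -\<alpha>)"
  have half: "(\<integral>\<^sup>+t. ?h t * indicator {0..} t \<partial>lborel) = ennreal (1 / (\<alpha> - 1))"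
  proof -
    have "(\<integral>\<^sup>+t. ?h t * indicator {0..} t \<partial>lborel) =
        ennreal (0 - (- ((1 + 0) powr (1 - \<alpha>)) / (\<alpha> - 1)))"
    proof (rule nn_integral_FTC_atLeast)
      fix x :: real assume "0 \<le> x"
      then have "((\<lambda>x. - ((1 + x) powr (1 - \<alpha>)) / (\<alpha> - 1)) has_real_derivative
          - ((1 - \<alpha>) * (1 + x) powr (1 - \<alpha> - 1)) / (\<alpha> - 1)) (at x)"
        using assms by (auto intro!: derivative_eq_intros)
      also have "- ((1 - \<alpha>) * (1 + x) powr (1 - \<alpha> - 1)) / (\<alpha> - 1) = (1 + \<bar>x\<bar>) powr -\<alpha>"
        using assms \<open>0 \<le> x\<close> by (simp add: field_simps)
      finally show "((\<lambda>x. - ((1 + x) powr (1 - \<alpha>)) / (\<alpha> - 1)) has_real_derivative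
          (1 + \<bar>x\<bar>) powr -\<alpha>) (at x)" .
    next
      have "((\<lambda>x::real. - ((1 + x) powr (1 - \<alpha>)) / (\<alpha> - 1)) \<longlongrightarrow> - 0 / (\<alpha> - 1)) at_top"
        using assms
        by (intro tendsto_intros tendsto_neg_powr filterlim_tendsto_add_at_top[OF tendsto_const]
            filterlim_ident) auto
      then show "((\<lambda>x::real. - ((1 + x) powr (1 - \<alpha>)) / (\<alpha> - 1)) \<longlongrightarrow> 0) at_top"
        by simp
    qed auto
    then show ?thesis
      by simp
  qed
  \<comment> \<open>The two half-lines overlap at 0, so the pointwise comparison is an
    inequality.\<close>
  have "(\<integral>\<^sup>+t. ?h t \<partial>lborel) \<le> (\<integral>\<^sup>+t. ?h t * indicator {0..} t + ?h (-t) * indicator {0..} (-t) \<partial>lborel)"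
    by (intro nn_integral_mono) (auto simp: indicator_def)
  also have "\<dots> = (\<integral>\<^sup>+t. ?h t * indicator {0..} t \<partial>lborel) + (\<integral>\<^sup>+t. ?h (-t) * indicator {0..} (-t) \<partial>lborel)"
    by (rule nn_integral_add) auto
  also have "(\<integral>\<^sup>+t. ?h (-t) * indicator {0..} (-t) \<partial>lborel) = (\<integral>\<^sup>+t. ?h t * indicator {0..} t \<partial>lborel)"
    by (subst (2) nn_integral_real_affine[where c="-1" and t=0]) auto
  also have "(\<integral>\<^sup>+t. ?h t * indicator {0..} t \<partial>lborel) + (\<integral>\<^sup>+t. ?h t * indicator {0..} t \<partial>lborel)
      = ennreal (2 / (\<alpha> - 1))"
    using assms unfolding half by (subst ennreal_plus[symmetric]) auto
  finally show ?thesis .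
qed

lemma std_normal_density_le_1: "std_normal_density x \<le> 1"
proof -
  have "1 \<le> sqrt (2 * pi)"
    using pi_gt3 by simp
  then have "1 / sqrt (2 * pi) * exp (- x\<^sup>2 / 2) \<le> 1 * 1"
    by (intro mult_mono) (auto simp: divide_le_eq)
  then show ?thesis
    by (simp add: std_normal_density_def)
qed

lemma one_plus_abs_powr_le_1:
  fixes x \<alpha> :: real
  assumes "\<alpha> \<ge> 0"
  shows "(1 + \<bar>x\<bar>) powr -\<alpha> \<le> 1"
  using powr_mono[of "-\<alpha>" 0 "1 + \<bar>x\<bar>"] assms by (simp add: add_nonneg_eq_0_iff)

lemma integrable_powr_decay:
  fixes N :: "'a measure" and f :: "'a \<Rightarrow> real"
  assumes "finite_measure N" "f \<in> borel_measurable N" "\<alpha> \<ge> 0"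
  shows "integrable N (\<lambda>x. (1 + \<bar>f x\<bar>) powr -\<alpha>)"
proof -
  interpret finite_measure N by fact
  note [measurable] = assms(2)
  show ?thesis
    using one_plus_abs_powr_le_1[OF assms(3)] by (intro integrable_const_bound[of _ 1]) auto
qed

text \<open>The normal density is at most 1, so the Lebesgue integral dominates, and the
  substitution \<open>t = c * u\<close> absorbs the factor \<open>c\<close>. The uniformity in
  \<open>c\<close> gives the factor \<open>1 / n\<close> of the upper bound.\<close>

lemma scaled_integral_powr_decay_le:
  assumes "\<alpha> > (1::real)" "c > 0"
  shows "c * (LINT u|std_normal_distribution. (1 + \<bar>c * u\<bar>) powr -\<alpha>) \<le> 2 / (\<alpha> - 1)"
proof -
  interpret N: prob_space std_normal_distribution by (rule prob_space_std_normal_distribution)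
  let ?h = "\<lambda>t::real. ennreal ((1 + \<bar>t\<bar>) powr -\<alpha>)"
  have "integrable std_normal_distribution (\<lambda>u. (1 + \<bar>c * u\<bar>) powr -\<alpha>)"
    using assms by (intro integrable_powr_decay) (auto intro: N.finite_measure_axioms)
  then have "ennreal (LINT u|std_normal_distribution. (1 + \<bar>c * u\<bar>) powr -\<alpha>) =
      (\<integral>\<^sup>+u. ?h (c * u) \<partial>std_normal_distribution)"
    by (intro nn_integral_eq_integral[symmetric]) auto
  also have "\<dots> = (\<integral>\<^sup>+u. ennreal (std_normal_density u) * ?h (c * u) \<partial>lborel)"
    by (rule nn_integral_density) auto
  also have "\<dots> \<le> (\<integral>\<^sup>+u. 1 * ?h (c * u) \<partial>lborel)"
    by (intro nn_integral_mono mult_right_mono) (auto simp: std_normal_density_le_1)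
  finally have "ennreal c * ennreal (LINT u|std_normal_distribution. (1 + \<bar>c * u\<bar>) powr -\<alpha>)
      \<le> ennreal c * (\<integral>\<^sup>+u. ?h (c * u) \<partial>lborel)"
    by (intro mult_left_mono) auto
  also have "\<dots> = (\<integral>\<^sup>+t. ?h t \<partial>lborel)"
    using assms by (subst (2) nn_integral_real_affine[where c=c and t=0]) auto
  also have "\<dots> \<le> ennreal (2 / (\<alpha> - 1))"
    by (rule nn_integral_powr_decay_le[OF assms(1)])
  finally show ?thesis
    using assms by (simp flip: ennreal_mult' add: ennreal_le_iff)
qed

text \<open>The source of \<epsilon>(b) \<rightarrow> 0. Dominated convergence with majorant 1; the
  integrand tends to 0 except at the null point \<open>v = 0\<close>, where it is constantly
  1.\<close>

lemma integral_powr_decay_tendsto_0: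
  assumes "\<beta> > (0::real)"
  shows "(\<lambda>k. LINT v|std_normal_distribution. (1 + \<bar>real k * v\<bar>) powr -\<beta>) \<longlonglongrightarrow> 0"
proof -
  interpret N: prob_space std_normal_distribution by (rule prob_space_std_normal_distribution)
  have "(\<lambda>k. LINT v|std_normal_distribution. (1 + \<bar>real k * v\<bar>) powr -\<beta>)
      \<longlonglongrightarrow> (LINT v|std_normal_distribution. 0)"
  proof (rule integral_dominated_convergence[where w="\<lambda>_. 1"])
    have "AE v in std_normal_distribution. v \<noteq> 0"
      using AE_lborel_singleton[of "0::real"] by (subst AE_density) auto
    then show "AE v in std_normal_distribution. (\<lambda>k. (1 + \<bar>real k * v\<bar>) powr -\<beta>) \<longlonglongrightarrow> 0"
    proof eventually_elim
      case (elim v)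
      have "filterlim (\<lambda>k. 1 + real k * \<bar>v\<bar>) at_top sequentially"
        using elim
        by (intro filterlim_tendsto_add_at_top[OF tendsto_const]
            filterlim_at_top_mult_tendsto_pos[OF tendsto_const] filterlim_real_sequentially) auto
      then show ?case
        using tendsto_neg_powr[of "-\<beta>" _ sequentially] assms by (simp add: abs_mult)
    qed
    fix k
    show "AE v in std_normal_distribution. norm ((1 + \<bar>real k * v\<bar>) powr -\<beta>) \<le> 1"
      using one_plus_abs_powr_le_1[of \<beta>] assms by simp
  qed auto
  then show ?thesis
    by simp
qed

section \<open>Upper and lower bounds for the Gaussian average\<close>

text \<open>Removes the singularity of the decay bound at the origin. For \<open>r \<le> 1\<close>
  the trivial bound \<open>F \<le> 1\<close> is combined with \<open>1 + r \<le> 2\<close>, for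
  \<open>r > 1\<close> the decay with \<open>1 + r \<le> 2 * r\<close>; the factor
  \<open>1 + C\<^sup>2\<close> covers both cases.\<close>

lemma square_le_of_powr_decay:
  fixes F r s :: real
  assumes "0 \<le> F" "F \<le> 1" "0 \<le> r" "0 \<le> s" and decay: "r \<noteq> 0 \<Longrightarrow> F \<le> C * r powr (- s / 2)"
  shows "F\<^sup>2 \<le> (1 + C\<^sup>2) * 2 powr s * (1 + r) powr -s"
proof -
  have F1: "F\<^sup>2 \<le> 1"
    using assms by (simp add: power_le_one)
  have cancel: "2 powr s * 2 powr -s = (1::real)"
    by (simp flip: powr_add)
  show ?thesis
  proof (cases "r \<le> 1")
    case True
    have le: "2 powr -s \<le> (1 + r) powr -s"
      using True assms by (intro powr_mono2') auto
    have "F\<^sup>2 \<le> 1 * 2 powr s * 2 powr -s"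
      using F1 cancel by simp
    also have "\<dots> \<le> (1 + C\<^sup>2) * 2 powr s * (1 + r) powr -s"
      using le by (intro mult_mono) auto
    finally show ?thesis .
  next
    case False
    have "F\<^sup>2 \<le> (C * r powr (- s / 2))\<^sup>2"
      using assms False by (intro power_mono) auto
    also have "\<dots> = C\<^sup>2 * r powr -s"
      using False by (simp add: power_mult_distrib power2_eq_square[of "r powr _"] flip: powr_add)
    also have "\<dots> \<le> (1 + C\<^sup>2) * ((1 + r) / 2) powr -s"
      using False assms by (intro mult_mono powr_mono2') auto
    also have "\<dots> = (1 + C\<^sup>2) * 2 powr s * (1 + r) powr -s"
      using assms by (simp add: powr_divide powr_minus field_simps)
    finally show ?thesis .
  qed
qed

text \<open>Decay in the full norm is distributed over the coordinates: an exponent above 1 makes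
  the horizontal factor integrable and yields \<open>1 / a\<close>, while the positive remainder
  survives as decay in the vertical frequency.\<close>

lemma gaussian_average_fourier_le:
  assumes "prob_space M" and M: "sets M = sets borel" and s: "s > 1"
    and decay: "\<And>\<xi>. \<xi> \<noteq> 0 \<Longrightarrow> norm (fourier_transform M \<xi>) \<le> C * norm \<xi> powr (- s / 2)"
    and a: "a > 0"
  shows "a * (LINT w|(std_normal_distribution \<Otimes>\<^sub>M std_normal_distribution).
      (norm (fourier_transform M (a * fst w, b * snd w)))\<^sup>2) \<le>
    (1 + C\<^sup>2) * 2 powr s * (4 / (s - 1)) *
      (LINT v|std_normal_distribution. (1 + \<bar>b * v\<bar>) powr -((s - 1) / 2))"
    (is "a * integral\<^sup>L ?W ?l \<le> _")
proof -
  interpret N: prob_space std_normal_distribution by (rule prob_space_std_normal_distribution)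
  interpret P: pair_sigma_finite std_normal_distribution std_normal_distribution ..
  interpret W: prob_space ?W by (rule prob_space_pair) unfold_locales
  \<comment> \<open>The excess of \<open>s\<close> over 1 is shared equally:
    \<open>\<alpha> - 1 = \<beta>\<close>.\<close>
  define \<alpha> \<beta> where "\<alpha> = (s + 1) / 2" and "\<beta> = (s - 1) / 2"
  define D where "D = (1 + C\<^sup>2) * 2 powr s"
  define g h where "g u = (1 + \<bar>a * u\<bar>) powr -\<alpha>" and "h v = (1 + \<bar>b * v\<bar>) powr -\<beta>" for u v
  have pos: "\<alpha> > 1" "\<beta> > 0" "s = \<alpha> + \<beta>" "D \<ge> 0"
    using s by (auto simp: \<alpha>_def \<beta>_def D_def field_simps)
  have [measurable]: "g \<in> borel_measurable borel" "h \<in> borel_measurable borel"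
    unfolding g_def h_def by measurable
  have gh: "0 \<le> g u" "g u \<le> 1" "0 \<le> h u" "h u \<le> 1" for u
    using one_plus_abs_powr_le_1[of \<alpha>] one_plus_abs_powr_le_1[of \<beta>] pos
    by (auto simp: g_def h_def)
  have int: "integrable ?W (\<lambda>w. g (fst w) * h (snd w))"
    by (rule W.integrable_const_bound[of _ 1]) (auto simp: gh abs_mult intro!: mult_le_one)
  have "?l w \<le> D * (g (fst w) * h (snd w))" for w
  proof -
    let ?r = "norm (a * fst w, b * snd w)"
    have r: "\<bar>a * fst w\<bar> \<le> ?r" "\<bar>b * snd w\<bar> \<le> ?r"
      by (metis norm_fst_le real_norm_def) (metis norm_snd_le real_norm_def)
    have "?l w \<le> D * (1 + ?r) powr -s"
      unfolding D_def
      using norm_fourier_transform_le_1[OF assms(1)] decay s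
      by (intro square_le_of_powr_decay) auto
    also have "(1 + ?r) powr -s = (1 + ?r) powr -\<alpha> * (1 + ?r) powr -\<beta>"
      by (simp add: pos flip: powr_add)
    \<comment> \<open>Replacing the norm by a single coordinate enlarges each negative power and
      separates the variables.\<close>
    also have "\<dots> \<le> g (fst w) * h (snd w)"
      using r pos unfolding g_def h_def by (intro mult_mono powr_mono2') auto
    finally show ?thesis
      using pos by (simp add: mult_left_mono)
  qed
  \<comment> \<open>\<open>integral_mono'\<close> asks for integrability of the nonnegative majorant
    alone, as a non-integrable left side would have integral 0 by default.\<close>
  then have "integral\<^sup>L ?W ?l \<le> (LINT w|?W. D * (g (fst w) * h (snd w)))"
    using int pos gh by (intro integral_mono') auto
  also have "\<dots> = D * (LINT w|?W. g (fst w) * h (snd w))"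
    by simp
  also have "(LINT w|?W. g (fst w) * h (snd w)) =
      (LINT u|std_normal_distribution. g u) * (LINT v|std_normal_distribution. h v)"
    by (subst P.integral_fst'[OF int, symmetric]) simp
  finally have "a * integral\<^sup>L ?W ?l \<le>
      a * (D * ((LINT u|std_normal_distribution. g u) * (LINT v|std_normal_distribution. h v)))"
    using a by (intro mult_left_mono) auto
  also have "\<dots> = D * (a * (LINT u|std_normal_distribution. g u)) * (LINT v|std_normal_distribution. h v)"
    by simp
  also have "\<dots> \<le> D * (2 / (\<alpha> - 1)) * (LINT v|std_normal_distribution. h v)"
    using scaled_integral_powr_decay_le[OF pos(1) a] pos gh
    by (intro mult_right_mono mult_left_mono integral_nonneg_AE) (auto simp: g_def)
  also have "2 / (\<alpha> - 1) = 4 / (s - 1)"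
    using s by (simp add: \<alpha>_def field_simps)
  finally show ?thesis
    by (simp add: D_def h_def \<beta>_def)
qed

text \<open>Once the strips are so thin that \<open>K\<close> varies by less than \<open>1 / b\<close> over each of them,
  the Gaussian is at least \<open>exp (- 4 * pi\<^sup>2)\<close> on all pairs of points from a common strip.\<close>
lemma gaussian_average_fourier_ge:
  assumes "prob_space M" and M: "sets M = sets borel"
    and K: "compact K" "inj_on fst K" "fst ` K \<subseteq> {0..1}" and b: "b > 0"
  shows "eventually (\<lambda>n. exp (- 4 * pi\<^sup>2) * (measure M K)\<^sup>2 / 2 \<le> real n *
    (LINT w|(std_normal_distribution \<Otimes>\<^sub>M std_normal_distribution).
      (norm (fourier_transform M (real n * fst w, b * snd w)))\<^sup>2)) sequentially"
proof -
  interpret M: prob_space M by fact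
  interpret Q: prob_space "M \<Otimes>\<^sub>M M" by (rule prob_space_pair) unfold_locales
  have [measurable_cong]: "sets M = sets (borel \<Otimes>\<^sub>M borel)"
    unfolding M borel_prod ..
  have sp: "space M = UNIV"
    using sets_eq_imp_space_eq[OF M] by simp
  have K_sets [measurable]: "K \<in> sets M"
    using K(1) M by (simp add: borel_compact)
  obtain e where e: "e > 0"
    "\<And>p q. p \<in> K \<Longrightarrow> q \<in> K \<Longrightarrow> dist (fst p) (fst q) < e \<Longrightarrow> dist (snd p) (snd q) < 1 / b"
    using compact_graph_modulus[OF K(1,2), of "1 / b"] b by auto
  \<comment> \<open>The modulus \<open>e\<close>, and with it \<open>n0\<close>, depends on
    \<open>b\<close>, so \<open>n\<close> has to be chosen after \<open>b\<close>.\<close>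
  obtain n0 where n0: "1 / e < real n0"
    using reals_Archimedean2 by blast
  show ?thesis
  proof (rule eventually_sequentiallyI[of "max 1 n0"])
    fix n assume "max 1 n0 \<le> n"
    then have n: "n > 0" "1 / real n < e"
      using n0 e(1) by (auto simp: field_simps intro: less_le_trans)
    let ?g = "\<lambda>z. exp (- 2 * pi\<^sup>2 *
      ((real n * (fst (fst z) - fst (snd z)))\<^sup>2 + (b * (snd (fst z) - snd (snd z)))\<^sup>2))"
    define S where "S = {z \<in> K \<times> K. \<bar>fst (fst z) - fst (snd z)\<bar> \<le> 1 / real n}"
    have "{z \<in> space (M \<Otimes>\<^sub>M M). z \<in> K \<times> K \<and> \<bar>fst (fst z) - fst (snd z)\<bar> \<le> 1 / real n} \<in> sets (M \<Otimes>\<^sub>M M)"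
      by measurable
    then have S: "S \<in> sets (M \<Otimes>\<^sub>M M)"
      by (simp add: S_def sp space_pair_measure)
    have bound: "exp (- 4 * pi\<^sup>2) * indicator S z \<le> ?g z" for z
    proof (cases "z \<in> S")
      case True
      then have z: "fst z \<in> K" "snd z \<in> K" "\<bar>fst (fst z) - fst (snd z)\<bar> \<le> 1 / real n"
        by (auto simp: S_def)
      then have "\<bar>snd (fst z) - snd (snd z)\<bar> < 1 / b"
        using e(2)[of "fst z" "snd z"] n(2) by (auto simp: dist_real_def)
      then have "b * \<bar>snd (fst z) - snd (snd z)\<bar> \<le> 1"
        using b by (simp add: field_simps)
      then have "\<bar>b * (snd (fst z) - snd (snd z))\<bar> \<le> 1"
        using b by (simp add: abs_mult)
      moreover have "\<bar>real n * (fst (fst z) - fst (snd z))\<bar> \<le> 1"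
        using z(3) n(1) by (simp add: abs_mult pos_le_divide_eq mult.commute)
      \<comment> \<open>Both scaled differences are at most 1 in modulus; with the factor
        \<open>2 * pi\<^sup>2\<close> this is where \<open>4 * pi\<^sup>2\<close> comes
        from.\<close>
      ultimately have "(real n * (fst (fst z) - fst (snd z)))\<^sup>2 + (b * (snd (fst z) - snd (snd z)))\<^sup>2 \<le> 1 + 1"
        by (intro add_mono) (simp_all only: abs_square_le_1)
      then have "2 * pi\<^sup>2 * ((real n * (fst (fst z) - fst (snd z)))\<^sup>2 + (b * (snd (fst z) - snd (snd z)))\<^sup>2)
          \<le> 2 * pi\<^sup>2 * (1 + 1)"
        by (intro mult_left_mono) auto
      then show ?thesis
        using True by simp
    qed auto
    \<comment> \<open>Multiplying the strip bound by \<open>n\<close> makes it independent of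
      \<open>n\<close>, at the cost of the factor 1/2.\<close>
    have "(measure M K)\<^sup>2 / 2 \<le> real n * ((measure M K)\<^sup>2 / (real n + 1))"
    proof -
      have "1 / 2 \<le> real n / (real n + 1)"
        using n(1) by (simp add: field_simps)
      from mult_left_mono[OF this, of "(measure M K)\<^sup>2"] show ?thesis
        by (simp add: algebra_simps)
    qed
    also have "\<dots> \<le> real n * measure (M \<Otimes>\<^sub>M M) S"
      unfolding S_def
      by (intro mult_left_mono measure_strip_ge) (use M K_sets K n M.finite_measure_axioms in auto)
    finally have "exp (- 4 * pi\<^sup>2) * ((measure M K)\<^sup>2 / 2) \<le> exp (- 4 * pi\<^sup>2) * (real n * measure (M \<Otimes>\<^sub>M M) S)"
      by (intro mult_left_mono) auto
    also have "\<dots> = real n * (LINT z|(M \<Otimes>\<^sub>M M). exp (- 4 * pi\<^sup>2) * indicator S z)"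
      using S by simp
    also have "\<dots> \<le> real n * (LINT z|(M \<Otimes>\<^sub>M M). ?g z)"
    proof (intro mult_left_mono integral_mono')
      show "integrable (M \<Otimes>\<^sub>M M) ?g"
        by (rule Q.integrable_const_bound[of _ 1]) (auto intro!: mult_nonneg_nonneg)
    qed (use bound in auto)
    also have "\<dots> = real n * (LINT w|(std_normal_distribution \<Otimes>\<^sub>M std_normal_distribution).
      (norm (fourier_transform M (real n * fst w, b * snd w)))\<^sup>2)"
      by (simp only: gaussian_energy[OF assms(1) M])
    finally show "exp (- 4 * pi\<^sup>2) * (measure M K)\<^sup>2 / 2 \<le> real n *
      (LINT w|(std_normal_distribution \<Otimes>\<^sub>M std_normal_distribution).
        (norm (fourier_transform M (real n * fst w, b * snd w)))\<^sup>2)"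
      by simp
  qed
qed

section \<open>Contradiction for exponents above 1\<close>

text \<open>For each vertical scale \<open>k\<close>, some \<open>n\<close> puts the average times
  \<open>n\<close> between \<open>\<delta>\<close> and \<open>A * J (real k)\<close>. Since
  \<open>\<delta>\<close> depends on neither \<open>n\<close> nor \<open>k\<close>, letting
  \<open>k\<close> grow forces \<open>\<delta> \<le> 0\<close>.\<close>

lemma fourier_decay_exponent_graph_le_1:
  assumes s: "s \<in> fourier_decay_exponents G" and G: "inj_on fst G" "fst ` G \<subseteq> {0..1}"
  shows "s \<le> 1"
proof (rule ccontr)
  assume "\<not> s \<le> 1"
  obtain M C where "M \<in> borel_prob_measures_on G"
    and decay: "\<And>\<xi>. \<xi> \<noteq> 0 \<Longrightarrow> norm (fourier_transform M \<xi>) \<le> C * norm \<xi> powr (- s / 2)"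
    using s by (auto simp: fourier_decay_exponents_def)
  then have M: "prob_space M" "sets M = sets borel" "measure_support M \<subseteq> G"
    by (auto simp: borel_prob_measures_on_def)
  interpret prob_space M by fact
  obtain K where K: "compact K" "K \<subseteq> measure_support M" "measure M K > 0"
    using exists_compact_subset_positive_measure[OF finite_measure_axioms M(2)
        closed_measure_support[OF M(2)]] measure_measure_support[OF M(1,2)] by auto
  define \<delta> where "\<delta> = exp (- 4 * pi\<^sup>2) * (measure M K)\<^sup>2 / 2"
  define J where "J b = (LINT v|std_normal_distribution. (1 + \<bar>b * v\<bar>) powr -((s - 1) / 2))" for b :: real
  define A where "A = (1 + C\<^sup>2) * 2 powr s * (4 / (s - 1))"
  have "\<delta> \<le> A * J (real k)" if "k > 0" for k :: nat
  proof -
    have "eventually (\<lambda>n. \<delta> \<le> real n *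
      (LINT w|(std_normal_distribution \<Otimes>\<^sub>M std_normal_distribution).
        (norm (fourier_transform M (real n * fst w, real k * snd w)))\<^sup>2)) sequentially"
      unfolding \<delta>_def using K M(3) G that
      by (intro gaussian_average_fourier_ge M(1,2)) (auto intro: inj_on_subset)
    \<comment> \<open>Positivity of \<open>n\<close> is requested as well, to meet the hypothesis
      \<open>a > 0\<close> of the upper bound.\<close>
    then obtain n where "n > 0" "\<delta> \<le> real n *
      (LINT w|(std_normal_distribution \<Otimes>\<^sub>M std_normal_distribution).
        (norm (fourier_transform M (real n * fst w, real k * snd w)))\<^sup>2)"
      using eventually_happens'[OF sequentially_bot eventually_conj[OF eventually_gt_at_top[of 0]]]
      by blast
    then show ?thesis
      using gaussian_average_fourier_le[OF M(1,2) _ decay, of "real n" "real k"] \<open>\<not> s \<le> 1\<close>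
      unfolding A_def J_def by simp
  qed
  moreover have "(\<lambda>k. A * J (real k)) \<longlonglongrightarrow> A * 0"
    unfolding J_def using \<open>\<not> s \<le> 1\<close> by (intro tendsto_intros integral_powr_decay_tendsto_0) auto
  ultimately have "\<delta> \<le> A * 0"
    by (intro Lim_bounded2[where N=1]) auto
  moreover have "\<delta> > 0"
    using K(3) by (simp add: \<delta>_def)
  ultimately show False
    by simp
qed

theorem theorem1p1:
  fixes f :: "real \<Rightarrow> real"
  shows "fourier_dim {(x, f x) | x. x \<in> {0..1}} \<le> 1"
  unfolding fourier_dim_def
proof (rule cSup_least)
  \<comment> \<open>A real supremum is controlled by upper bounds only for a nonempty set; the point
    mass at \<open>(0, f 0)\<close> supplies the exponent 0.\<close>
  show "fourier_decay_exponents {(x, f x) |x. x \<in> {0..1}} \<noteq> {}"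
    using zero_in_fourier_decay_exponents[of "(0, f 0)" "{(x, f x) |x. x \<in> {0..1}}"] by auto
qed (rule fourier_decay_exponent_graph_le_1, auto simp: inj_on_def)

end
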